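(* For every set $K\subset\mathbb{R}^n$ that is the support of an absolutely decaying measure there exists $\alpha=\alpha(K)>0$ such that for every $m\in\mathbb{N}$ and every $A\in\operatorname{M}_{n\times m}(\mathbb{R})$, the set $$\mathbf{Bad}_A(n,m)=\Big\{\mathbf{x}\in\mathbb{R}^n:\ \inf_{\mathbf{q}\in\mathbb{Z}^m\setminus\{0\}}\|\mathbf{q}\|^{m/n}\,d(A\mathbf{q}-\mathbf{x},\mathbb{Z}^n)>0\Big\}$$ is $\alpha$-winning on $K$.
   Context: $d$ is Euclidean distance and $d(\mathbf{v},\mathbb{Z}^n)=\min_{\mathbf{p}\in\mathbb{Z}^n}d(\mathbf{v},\mathbf{p})$. For a closed set $K\subset\mathbb{R}^n$ and $0<\alpha,\beta<1$, Schmidt's $(\alpha,\beta)$-game on $K$ with target set $S$: balls are $B(\mathbf{x},\rho)=\{\mathbf{x}'\in K: d(\mathbf{x},\mathbf{x}')\le\rho\}$ with $\mathbf{x}\in K$, $\rho>0$, and $(\mathbf{x}_2,\rho_2)\le_s(\mathbf{x}_1,\rho_1)$ means $\rho_2+d(\mathbf{x}_1,\mathbf{x}_2)\le\rho_1$. Bob picks $\omega_1=(\mathbf{x}_1,\rho_1)$; then Alice and Bob alternately pick $\omega_k'=(\mathbf{x}_k',\rho_k')\le_s\omega_k$ and $\omega_{k+1}\le_s\omega_k'$, centers in $K$, with $\rho_k'=\alpha\rho_k$, $\rho_{k+1}=\beta\rho_k'$. The nested balls intersect in one point $\mathbf{x}_\infty$; Alice wins if $\mathbf{x}_\infty\in S$.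 $S$ is $(\alpha,\beta)$-winning on $K$ if Alice has a strategy guaranteeing $\mathbf{x}_\infty\in S\cap K$, and $\alpha$-winning on $K$ if this holds for every $\beta\in(0,1)$. A locally finite Borel measure $\mu$ on $\mathbb{R}^n$ is $(C,\gamma)$-absolutely decaying ($C,\gamma>0$) if there is $\rho_0>0$ with $\mu(B(\mathbf{x},\rho)\cap\mathcal L^{(\varepsilon)})<C(\varepsilon/\rho)^\gamma\mu(B(\mathbf{x},\rho))$ for every affine hyperplane $\mathcal L$, $\mathbf{x}\in\operatorname{supp}\mu$, $0<\rho<\rho_0$, $\varepsilon>0$ (closed Euclidean balls; $\mathcal L^{(\varepsilon)}$ the closed $\varepsilon$-neighborhood of $\mathcal L$); $\mu$ is absolutely decaying if it is $(C,\gamma)$-absolutely decaying for some $C,\gamma>0$. *)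

theory Defs
  imports "HOL-Analysis.Analysis"
begin

definition affine_hyperplane :: "('a::euclidean_space) set \<Rightarrow> bool" where
  "affine_hyperplane L \<longleftrightarrow> (\<exists>a c. a \<noteq> 0 \<and> L = {y. a \<bullet> y = c})"

definition nbhd :: "('a::euclidean_space) set \<Rightarrow> real \<Rightarrow> 'a set" where
  "nbhd L eps = {y. \<exists>z\<in>L. dist y z \<le> eps}"

definition locally_finite_borel :: "('a::euclidean_space) measure \<Rightarrow> bool" where
  "locally_finite_borel \<mu> \<longleftrightarrow> sets \<mu> = sets borel \<and>
     (\<forall>x. \<exists>U. open U \<and> x \<in> U \<and> emeasure \<mu> U < \<infinity>)"

definition measure_support :: "('a::euclidean_space) measure \<Rightarrow> 'a set" where
  "measure_support \<mu> = {x. \<forall>r>0. emeasure \<mu> (ball x r) > 0}"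

definition abs_decaying_with :: "real \<Rightarrow> real \<Rightarrow> ('a::euclidean_space) measure \<Rightarrow> bool" where
  "abs_decaying_with C \<gamma> \<mu> \<longleftrightarrow> locally_finite_borel \<mu> \<and> C > 0 \<and> \<gamma> > 0 \<and>
     (\<exists>\<rho>0>0. \<forall>L x \<rho> eps. affine_hyperplane L \<longrightarrow> x \<in> measure_support \<mu> \<longrightarrow>
        0 < \<rho> \<longrightarrow> \<rho> < \<rho>0 \<longrightarrow> eps > 0 \<longrightarrow>
        emeasure \<mu> (cball x \<rho> \<inter> nbhd L eps)
          < ennreal (C * (eps / \<rho>) powr \<gamma>) * emeasure \<mu> (cball x \<rho>))"

definition abs_decaying :: "('a::euclidean_space) measure \<Rightarrow> bool" where
  "abs_decaying \<mu> \<longleftrightarrow> (\<exists>C \<gamma>. abs_decaying_with C \<gamma> \<mu>)"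

text \<open>A move is a pair (centre, radius); the ball on K is cball x r intersected with K.\<close>
definition Kball :: "'a::metric_space set \<Rightarrow> 'a \<times> real \<Rightarrow> 'a set" where
  "Kball K w = {x' \<in> K. dist (fst w) x' \<le> snd w}"

definition sub_s :: "'a::metric_space \<times> real \<Rightarrow> 'a \<times> real \<Rightarrow> bool" where
  "sub_s w2 w1 \<longleftrightarrow> snd w2 + dist (fst w1) (fst w2) \<le> snd w1"

text \<open>Alice's strategy F receives the list of Bob's moves so far (b 0, ..., b k) and returns
  her move a k (her own earlier moves are determined by F and Bob's earlier moves).
  Indices start at 0.\<close>
definition alice_move :: "(('a \<times> real) list \<Rightarrow> 'a \<times> real) \<Rightarrow> (nat \<Rightarrow> 'a \<times> real) \<Rightarrow> nat \<Rightarrow> 'a \<times> real" where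
  "alice_move F b k = F (map b [0..<Suc k])"

definition bob_legal :: "real \<Rightarrow> real \<Rightarrow> 'a::metric_space set \<Rightarrow> (('a \<times> real) list \<Rightarrow> 'a \<times> real)
    \<Rightarrow> (nat \<Rightarrow> 'a \<times> real) \<Rightarrow> nat \<Rightarrow> bool" where
  "bob_legal \<alpha> \<beta> K F b k \<longleftrightarrow>
     fst (b 0) \<in> K \<and> snd (b 0) > 0 \<and>
     (\<forall>j<k. fst (b (Suc j)) \<in> K \<and> snd (b (Suc j)) = \<beta> * (\<alpha> * snd (b j)) \<and>
            sub_s (b (Suc j)) (alice_move F b j))"

definition alice_legal :: "real \<Rightarrow> 'a::metric_space set \<Rightarrow> ('a \<times> real) \<Rightarrow> ('a \<times> real) \<Rightarrow> bool" where
  "alice_legal \<alpha> K w a \<longleftrightarrow> fst a \<in> K \<and> snd a = \<alpha> * snd w \<and> sub_s a w"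

definition ab_winning :: "real \<Rightarrow> real \<Rightarrow> 'a::metric_space set \<Rightarrow> 'a set \<Rightarrow> bool" where
  "ab_winning \<alpha> \<beta> K S \<longleftrightarrow> 0 < \<alpha> \<and> \<alpha> < 1 \<and> 0 < \<beta> \<and> \<beta> < 1 \<and>
     (\<exists>F. \<forall>b.
        (\<forall>k. bob_legal \<alpha> \<beta> K F b k \<longrightarrow> alice_legal \<alpha> K (b k) (alice_move F b k)) \<and>
        ((\<forall>k. bob_legal \<alpha> \<beta> K F b k) \<longrightarrow>
           (\<forall>x. (\<forall>k. x \<in> Kball K (b k)) \<longrightarrow> x \<in> S \<inter> K)))"

definition alpha_winning :: "real \<Rightarrow> 'a::metric_space set \<Rightarrow> 'a set \<Rightarrow> bool" where
  "alpha_winning \<alpha> K S \<longleftrightarrow> 0 < \<alpha> \<and> \<alpha> < 1 \<and> (\<forall>\<beta>. 0 < \<beta> \<and> \<beta> < 1 \<longrightarrow> ab_winning \<alpha> \<beta> K S)"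

definition int_points :: "(real ^ 'n) set" where
  "int_points = {p. \<forall>i. p $ i \<in> \<int>}"

text \<open>A matrix in M_{n x m}(R) is given by its m columns A 0, ..., A (m-1) in R^n;
  an integer vector q in Z^m is a function nat => int (only q 0..q (m-1) matter).\<close>
definition mat_vec :: "nat \<Rightarrow> (nat \<Rightarrow> real ^ 'n) \<Rightarrow> (nat \<Rightarrow> int) \<Rightarrow> real ^ 'n" where
  "mat_vec m A q = (\<Sum>j<m. of_int (q j) *\<^sub>R A j)"

definition int_norm :: "nat \<Rightarrow> (nat \<Rightarrow> int) \<Rightarrow> real" where
  "int_norm m q = sqrt (\<Sum>j<m. (of_int (q j))\<^sup>2)"

definition Bad :: "nat \<Rightarrow> (nat \<Rightarrow> real ^ 'n) \<Rightarrow> (real ^ 'n) set" where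
  "Bad m A = {x. 0 < (INF q \<in> {q. (\<forall>j\<ge>m. q j = 0) \<and> (\<exists>j<m. q j \<noteq> 0)}.
        int_norm m q powr (real m / real CARD('n)) * infdist (mat_vec m A q - x) int_points)}"

end

theory Submission
  imports Defs
begin

text \<open>
  Transference: for every \<open>j\<close> let \<open>y\<^sub>j\<close> be a nonzero integer vector of least norm such that all
  entries of \<open>A\<^sup>T y\<^sub>j\<close> are within \<open>2\<^sup>-\<^sup>j\<close> of an integer. Dirichlet's theorem bounds
  \<open>|y\<^sub>j|\<close> by a multiple of \<open>2\<close> to the power \<open>jm/n\<close>, and pairing \<open>A q - x - p\<close> with a suitable
  \<open>y\<^sub>j\<close> shows that \<open>x\<close> lies in \<open>Bad\<close> as soon as \<open>y\<^sub>j \<bullet> x\<close> stays away from the integers uniformly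
  in \<open>j\<close>. Minimality and the pigeonhole principle bound the number of distinct \<open>y\<^sub>j\<close> with norm in
  any dyadic interval.

  In the game Alice therefore has to avoid neighbourhoods of hyperplanes \<open>y\<^sub>j \<bullet> x = p\<close>. Over \<open>r\<close>
  consecutive moves the ball meets a number of relevant hyperplanes that is linear in \<open>r\<close>. As each of
  their neighbourhoods carries at most half of the measure of the ball, some centre in the support
  avoids at least half of them. So \<open>r\<close> moves dispose of \<open>2\<^sup>r\<close> hyperplanes, and \<open>\<alpha>\<close> need not depend
  on the sparseness constant, hence not on \<open>m\<close> or \<open>A\<close>.
\<close>

section \<open>Measure of the support and of balls, and an averaging argument\<close>

text \<open>Points off the support have open null neighbourhoods, and by Lindelof countably many of
  these cover the complement.\<close>

lemma null_complement_measure_support: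
  fixes \<mu> :: "'a::euclidean_space measure"
  assumes "sets \<mu> = sets borel"
  shows "- measure_support \<mu> \<in> null_sets \<mu>"
proof -
  define F where "F = {U. open U \<and> emeasure \<mu> U = 0}"
  obtain F' where F': "F' \<subseteq> F" "countable F'" "\<Union>F' = \<Union>F"
    using Lindelof[of F] unfolding F_def by blast
  have "- measure_support \<mu> = \<Union>F"
  proof (intro equalityI subsetI)
    fix x assume "x \<in> - measure_support \<mu>"
    then obtain r where "r > 0" "emeasure \<mu> (ball x r) = 0"
      by (auto simp: measure_support_def)
    then show "x \<in> \<Union>F" unfolding F_def by (intro UnionI[of "ball x r"]) auto
  next
    fix x assume "x \<in> \<Union>F"
    then obtain U where U: "open U" "emeasure \<mu> U = 0" "x \<in> U" by (auto simp: F_def)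
    then obtain r where r: "r > 0" "ball x r \<subseteq> U" by (meson openE)
    have "emeasure \<mu> (ball x r) \<le> emeasure \<mu> U"
      using r U assms by (intro emeasure_mono) auto
    then show "x \<in> - measure_support \<mu>" using U r by (auto simp: measure_support_def)
  qed
  also have "\<dots> = (\<Union>U\<in>F'. U)" using F' by auto
  also have "\<dots> \<in> null_sets \<mu>"
    using F' assms by (intro null_sets_UN') (auto simp: F_def null_sets_def)
  finally show ?thesis .
qed

lemma emeasure_cball_finite:
  fixes \<mu> :: "'a::euclidean_space measure"
  assumes "locally_finite_borel \<mu>"
  shows "emeasure \<mu> (cball x r) < \<infinity>"
proof -
  have s: "sets \<mu> = sets borel" using assms by (simp add: locally_finite_borel_def)
  obtain U where U: "\<And>z. open (U z)" "\<And>z. z \<in> U z" "\<And>z. emeasure \<mu> (U z) < \<infinity>"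
    using assms unfolding locally_finite_borel_def by metis
  obtain T where T: "T \<subseteq> cball x r" "finite T" "cball x r \<subseteq> (\<Union>z\<in>T. U z)"
    using compactE_image[OF compact_cball, of "cball x r" U x r] U by blast
  have "emeasure \<mu> (cball x r) \<le> emeasure \<mu> (\<Union>z\<in>T. U z)"
    using T U s by (intro emeasure_mono) auto
  also have "\<dots> \<le> (\<Sum>z\<in>T. emeasure \<mu> (U z))"
    using T U s by (intro emeasure_subadditive_finite) auto
  also have "\<dots> < \<infinity>" using T U by (auto simp: less_top)
  finally show ?thesis .
qed

text \<open>Averaging: if every support point of the ball lay in more than half of the sets,
  integrating the number of sets containing \<open>z\<close> over the ball would contradict
  \<open>half\<close>. Points off the support are negligible, so the point found can be taken in the
  support, as a legal centre must be.\<close>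

lemma exists_point_in_few_sets:
  fixes \<mu> :: "'a::euclidean_space measure"
  assumes lf: "locally_finite_borel \<mu>" and x: "x \<in> measure_support \<mu>" and r: "r > 0"
    and I: "finite I" and H: "\<And>i. i \<in> I \<Longrightarrow> H i \<in> sets borel"
    and half: "\<And>i. i \<in> I \<Longrightarrow> 2 * emeasure \<mu> (cball x r \<inter> H i) \<le> emeasure \<mu> (cball x r)"
  shows "\<exists>x'\<in>measure_support \<mu> \<inter> cball x r. 2 * card {i\<in>I. x' \<in> H i} \<le> card I"
proof (rule ccontr)
  assume "\<not> ?thesis"
  then have "card I < 2 * card {i\<in>I. z \<in> H i}" if "z \<in> measure_support \<mu> \<inter> cball x r" for z
    using that not_le by blast
  then have many: "card I + 1 \<le> 2 * card {i\<in>I. z \<in> H i}"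
    if "z \<in> measure_support \<mu>" "z \<in> cball x r" for z
    using that by (metis IntI Suc_eq_plus1 Suc_leI)
  have s: "sets \<mu> = sets borel" using lf by (simp add: locally_finite_borel_def)
  let ?B = "cball x r"
  have AE: "AE z in \<mu>. z \<in> measure_support \<mu>"
    using AE_not_in[OF null_complement_measure_support[OF s]] by auto
  have pos: "emeasure \<mu> ?B > 0"
  proof -
    have "0 < emeasure \<mu> (ball x r)" using x r by (auto simp: measure_support_def)
    also have "\<dots> \<le> emeasure \<mu> ?B" using s by (intro emeasure_mono) auto
    finally show ?thesis .
  qed
  have fin: "emeasure \<mu> ?B < \<infinity>" by (rule emeasure_cball_finite[OF lf])
  have "of_nat (card I + 1) * emeasure \<mu> ?B = (\<integral>\<^sup>+z. of_nat (card I + 1) * indicator ?B z \<partial>\<mu>)"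
    using s by (subst nn_integral_cmult_indicator) auto
  also have "\<dots> \<le> (\<integral>\<^sup>+z. (\<Sum>i\<in>I. 2 * indicator (?B \<inter> H i) z) \<partial>\<mu>)"
  proof (rule nn_integral_mono_AE, rule eventually_mono[OF AE])
    fix z assume z: "z \<in> measure_support \<mu>"
    show "of_nat (card I + 1) * indicator ?B z \<le> (\<Sum>i\<in>I. 2 * indicator (?B \<inter> H i) z :: ennreal)"
    proof (cases "z \<in> ?B")
      case True
      have "(\<Sum>i\<in>I. 2 * indicator (?B \<inter> H i) z :: ennreal)
        = (\<Sum>i\<in>I. if z \<in> H i then 2 else 0)"
        using True by (intro sum.cong) (auto simp: indicator_def)
      also have "\<dots> = (\<Sum>i\<in>{i\<in>I. z \<in> H i}. 2)"
        by (rule sum.inter_filter[OF I, symmetric])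
      also have "\<dots> = of_nat (2 * card {i\<in>I. z \<in> H i})" by (simp add: mult.commute)
      finally have eq: "(\<Sum>i\<in>I. 2 * indicator (?B \<inter> H i) z :: ennreal)
        = of_nat (2 * card {i\<in>I. z \<in> H i})" .
      have "(of_nat (card I + 1) :: ennreal) \<le> of_nat (2 * card {i\<in>I. z \<in> H i})"
        using many[OF z True] by (intro of_nat_mono)
      then show ?thesis unfolding eq using True by simp
    qed simp
  qed
  also have "\<dots> = (\<Sum>i\<in>I. 2 * emeasure \<mu> (?B \<inter> H i))"
  proof (subst nn_integral_sum)
    have m: "?B \<inter> H i \<in> sets \<mu>" if "i \<in> I" for i using H[OF that] s by auto
    show "(\<lambda>z. 2 * indicator (?B \<inter> H i) z :: ennreal) \<in> borel_measurable \<mu>" if "i \<in> I" for i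
      using m[OF that] by measurable
    show "(\<Sum>i\<in>I. \<integral>\<^sup>+z. 2 * indicator (?B \<inter> H i) z \<partial>\<mu>) = (\<Sum>i\<in>I. 2 * emeasure \<mu> (?B \<inter> H i))"
      using m by (intro sum.cong) (auto simp: nn_integral_cmult_indicator)
  qed
  also have "\<dots> \<le> (\<Sum>i\<in>I. emeasure \<mu> ?B)" by (intro sum_mono half)
  also have "\<dots> = of_nat (card I) * emeasure \<mu> ?B" by simp
  finally have le: "of_nat (card I + 1) * emeasure \<mu> ?B \<le> of_nat (card I) * emeasure \<mu> ?B" .
  \<comment> \<open>Cancelling the measure of the ball needs it positive and finite, so the
    comparison passes to real numbers.\<close>
  define e where "e = enn2real (emeasure \<mu> ?B)"
  have e: "emeasure \<mu> ?B = ennreal e" using fin by (simp add: e_def less_top)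
  have "e > 0" using pos e by (metis ennreal_less_zero_iff)
  have "ennreal (real (card I + 1) * e) \<le> ennreal (real (card I) * e)"
    using le \<open>e > 0\<close> unfolding e by (simp add: ennreal_mult ennreal_of_nat_eq_real_of_nat del: of_nat_add of_nat_Suc)
  then show False using \<open>e > 0\<close> by (simp add: ennreal_le_iff algebra_simps)
qed

section \<open>Hyperplane neighbourhoods and a single halving move\<close>

lemma nbhd_hyperplane:
  fixes a :: "'a::euclidean_space"
  assumes "a \<noteq> 0"
  shows "nbhd {z. a \<bullet> z = c} eps = {z. \<bar>a \<bullet> z - c\<bar> \<le> eps * norm a}"
proof (intro equalityI subsetI; clarsimp simp: nbhd_def)
  fix y z assume z: "dist y z \<le> eps" "c = a \<bullet> z"
  have "\<bar>a \<bullet> y - a \<bullet> z\<bar> \<le> norm a * norm (y - z)"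
    by (metis Cauchy_Schwarz_ineq2 inner_diff_right)
  also have "\<dots> \<le> norm a * eps" using z by (intro mult_left_mono) (auto simp: dist_norm)
  finally show "\<bar>a \<bullet> y - a \<bullet> z\<bar> \<le> eps * norm a" by (simp add: mult.commute)
next
  fix y assume y: "\<bar>a \<bullet> y - c\<bar> \<le> eps * norm a"
  \<comment> \<open>The orthogonal projection of \<open>y\<close> to the hyperplane.\<close>
  define z where "z = y - ((a \<bullet> y - c) / (a \<bullet> a)) *\<^sub>R a"
  have "a \<bullet> z = c" using assms by (simp add: z_def inner_diff_right)
  moreover have "dist y z \<le> eps"
  proof -
    have "dist y z = \<bar>a \<bullet> y - c\<bar> / norm a"
      using assms by (simp add: z_def dist_norm dot_square_norm power2_eq_square)
    also have "\<dots> \<le> eps" using y assms by (simp add: pos_divide_le_eq)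
    finally show ?thesis .
  qed
  ultimately show "\<exists>z. a \<bullet> z = c \<and> dist y z \<le> eps" by blast
qed

text \<open>The ball is taken in the whole space rather than in the support. The threshold \<delta>
  bounds the value \<open>y \<bullet> z - p\<close> rather than the distance to the hyperplane, so
  that a single \<delta> can serve vectors of all lengths.\<close>

definition bad_vectors :: "real \<Rightarrow> 'a::euclidean_space set \<Rightarrow> 'a \<Rightarrow> real \<Rightarrow> 'a set" where
  "bad_vectors \<delta> V x \<rho> = {y\<in>V. \<exists>z. \<exists>p\<in>\<int>. dist x z \<le> \<rho> \<and> \<bar>y \<bullet> z - p\<bar> < \<delta>}"

lemma bad_vectors_mono:
  "dist x x' + \<rho>' \<le> \<rho> \<Longrightarrow> bad_vectors \<delta> V x' \<rho>' \<subseteq> bad_vectors \<delta> V x \<rho>"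
proof -
  assume "dist x x' + \<rho>' \<le> \<rho>"
  then have "dist x z \<le> \<rho>" if "dist x' z \<le> \<rho>'" for z
    using that dist_triangle[of x z x'] by linarith
  then show ?thesis unfolding bad_vectors_def by blast
qed

text \<open>If a vector stays bad for the new ball, \<open>V2\<close> puts the new centre within
  \<open>2 * \<alpha> * \<rho>\<close> of its hyperplane. There is one such neighbourhood per bad
  vector, and averaging yields a centre in at most half of them. Searching within
  \<open>(1 - \<alpha>) * \<rho>\<close> keeps the new ball inside the old one.\<close>

lemma halve_bad_vectors:
  fixes \<mu> :: "'a::euclidean_space measure"
  assumes lf: "locally_finite_borel \<mu>" and x: "x \<in> measure_support \<mu>"
    and \<alpha>: "0 < \<alpha>" "\<alpha> < 1" and \<rho>: "0 < \<rho>" and V: "finite V"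
    and half: "\<And>L. affine_hyperplane L \<Longrightarrow>
      2 * emeasure \<mu> (cball x ((1 - \<alpha>) * \<rho>) \<inter> nbhd L (2 * \<alpha> * \<rho>)) \<le> emeasure \<mu> (cball x ((1 - \<alpha>) * \<rho>))"
    and V1: "\<And>y. y \<in> V \<Longrightarrow> y \<noteq> 0"
    and V2: "\<And>y. y \<in> V \<Longrightarrow> \<delta> \<le> norm y * (\<alpha> * \<rho>)"
    and V3: "\<And>y. y \<in> V \<Longrightarrow> 2 * \<delta> + 2 * (norm y * \<rho>) < 1"
  shows "\<exists>x'\<in>measure_support \<mu>. dist x x' \<le> (1 - \<alpha>) * \<rho> \<and>
    2 * card (bad_vectors \<delta> V x' (\<alpha> * \<rho>)) \<le> card (bad_vectors \<delta> V x \<rho>)"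
proof -
  let ?I = "bad_vectors \<delta> V x \<rho>"
  have I: "finite ?I" "?I \<subseteq> V" using V by (auto simp: bad_vectors_def)
  have ex: "\<forall>y\<in>?I. \<exists>p. p \<in> \<int> \<and> (\<exists>z. dist x z \<le> \<rho> \<and> \<bar>y \<bullet> z - p\<bar> < \<delta>)"
    by (auto simp: bad_vectors_def)
  obtain p where p: "\<And>y. y \<in> ?I \<Longrightarrow> p y \<in> \<int> \<and> (\<exists>z. dist x z \<le> \<rho> \<and> \<bar>y \<bullet> z - p y\<bar> < \<delta>)"
    using bchoice[OF ex] by auto
  \<comment> \<open>The balls are so small that each vector contributes at most one hyperplane.\<close>
  have uniq: "q = p y" if y: "y \<in> ?I" and q: "q \<in> \<int>" "dist x z \<le> \<rho>" "\<bar>y \<bullet> z - q\<bar> < \<delta>" for y z q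
  proof -
    obtain z' where z': "dist x z' \<le> \<rho>" "\<bar>y \<bullet> z' - p y\<bar> < \<delta>" using p[OF y] by auto
    have "\<bar>y \<bullet> z - y \<bullet> z'\<bar> \<le> norm y * norm (z - z')"
      by (metis Cauchy_Schwarz_ineq2 inner_diff_right)
    also have "\<dots> \<le> norm y * (2 * \<rho>)"
      using q(2) z'(1) by (intro mult_left_mono) (simp_all add: dist_norm[symmetric], metric)
    finally have "\<bar>q - p y\<bar> < 1" using q(3) z'(2) V3[of y] y I by (auto simp: algebra_simps)
    then show ?thesis using Ints_eq_abs_less1[of q "p y"] q(1) p[OF y] by blast
  qed
  define H where "H y = nbhd {z. y \<bullet> z = p y} (2 * \<alpha> * \<rho>)" for y
  have H: "H y = {z. \<bar>y \<bullet> z - p y\<bar> \<le> 2 * \<alpha> * \<rho> * norm y}" if "y \<in> ?I" for y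
    unfolding H_def using that V1 I by (intro nbhd_hyperplane) auto
  have "\<exists>x'\<in>measure_support \<mu> \<inter> cball x ((1 - \<alpha>) * \<rho>). 2 * card {y\<in>?I. x' \<in> H y} \<le> card ?I"
  proof (rule exists_point_in_few_sets[OF lf x _ I(1)])
    show "0 < (1 - \<alpha>) * \<rho>" using \<alpha> \<rho> by simp
    show "H y \<in> sets borel" if "y \<in> ?I" for y
      unfolding H[OF that] by measurable
    show "2 * emeasure \<mu> (cball x ((1 - \<alpha>) * \<rho>) \<inter> H y) \<le> emeasure \<mu> (cball x ((1 - \<alpha>) * \<rho>))"
      if "y \<in> ?I" for y
      unfolding H_def
      by (rule half) (use that V1 I in \<open>auto simp: affine_hyperplane_def\<close>)
  qed
  then obtain x' where x': "x' \<in> measure_support \<mu>" "dist x x' \<le> (1 - \<alpha>) * \<rho>"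
    "2 * card {y\<in>?I. x' \<in> H y} \<le> card ?I" by auto
  have "bad_vectors \<delta> V x' (\<alpha> * \<rho>) \<subseteq> {y\<in>?I. x' \<in> H y}"
  proof
    fix y assume y: "y \<in> bad_vectors \<delta> V x' (\<alpha> * \<rho>)"
    have yI: "y \<in> ?I"
      using bad_vectors_mono[of x x' "\<alpha> * \<rho>" \<rho>] x' y by (auto simp: algebra_simps)
    obtain z q where z: "q \<in> \<int>" "dist x' z \<le> \<alpha> * \<rho>" "\<bar>y \<bullet> z - q\<bar> < \<delta>"
      using y by (auto simp: bad_vectors_def)
    have "dist x z \<le> \<rho>" using dist_triangle[of x z x'] z x' by (auto simp: algebra_simps)
    then have q: "q = p y" using uniq[OF yI] z by blast
    have "\<bar>y \<bullet> x' - y \<bullet> z\<bar> \<le> norm y * norm (x' - z)"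
      by (metis Cauchy_Schwarz_ineq2 inner_diff_right)
    also have "\<dots> \<le> norm y * (\<alpha> * \<rho>)"
      using z by (intro mult_left_mono) (simp_all add: dist_norm)
    finally have "\<bar>y \<bullet> x' - p y\<bar> \<le> 2 * \<alpha> * \<rho> * norm y"
      using z(3) q V2[of y] yI I by (auto simp: algebra_simps)
    then show "y \<in> {y\<in>?I. x' \<in> H y}" using yI H[OF yI] by auto
  qed
  then have "card (bad_vectors \<delta> V x' (\<alpha> * \<rho>)) \<le> card {y\<in>?I. x' \<in> H y}"
    using I by (intro card_mono) auto
  then show ?thesis using x' by (intro bexI[of _ x']) auto
qed

lemma exists_halving_constant:
  fixes \<mu> :: "'a::euclidean_space measure"
  assumes "abs_decaying \<mu>"
  obtains \<alpha> \<rho>0 where "0 < \<alpha>" "\<alpha> < 1" "0 < \<rho>0"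
    "\<And>x \<rho> L. \<lbrakk>x \<in> measure_support \<mu>; 0 < \<rho>; \<rho> < \<rho>0; affine_hyperplane L\<rbrakk> \<Longrightarrow>
      2 * emeasure \<mu> (cball x ((1 - \<alpha>) * \<rho>) \<inter> nbhd L (2 * \<alpha> * \<rho>)) \<le> emeasure \<mu> (cball x ((1 - \<alpha>) * \<rho>))"
proof -
  obtain C \<gamma> \<rho>0 where C: "C > 0" "\<gamma> > 0" "\<rho>0 > 0"
    and dec: "\<And>L x \<rho> eps. \<lbrakk>affine_hyperplane L; x \<in> measure_support \<mu>; 0 < \<rho>; \<rho> < \<rho>0; eps > 0\<rbrakk> \<Longrightarrow>
        emeasure \<mu> (cball x \<rho> \<inter> nbhd L eps)
          < ennreal (C * (eps / \<rho>) powr \<gamma>) * emeasure \<mu> (cball x \<rho>)"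
    using assms unfolding abs_decaying_def abs_decaying_with_def by blast
  \<comment> \<open>\<open>t\<close> solves \<open>C * t powr \<gamma> = 1 / 2\<close>. The cap
    \<open>1/2\<close> on \<alpha> bounds the ratio \<open>2 * \<alpha> / (1 - \<alpha>)\<close> of
    width to radius by \<open>4 * \<alpha>\<close>, and \<open>t / 4\<close> bounds this by
    \<open>t\<close>.\<close>
  define t where "t = (1 / (2 * C)) powr (1 / \<gamma>)"
  define \<alpha> where "\<alpha> = min (1/2) (t / 4)"
  have t: "t > 0" "t powr \<gamma> = 1 / (2 * C)" using C by (simp_all add: t_def powr_powr)
  have \<alpha>: "0 < \<alpha>" "\<alpha> \<le> 1/2" "4 * \<alpha> \<le> t" using t by (auto simp: \<alpha>_def)
  show ?thesis
  proof (rule that[of \<alpha> \<rho>0])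
    fix x \<rho> and L :: "'a set" assume x: "x \<in> measure_support \<mu>" "0 < \<rho>" "\<rho> < \<rho>0" "affine_hyperplane L"
    let ?r = "(1 - \<alpha>) * \<rho>" and ?e = "2 * \<alpha> * \<rho>"
    have "?r \<le> 1 * \<rho>" using \<alpha> x by (intro mult_right_mono) auto
    then have "?r < \<rho>0" using x(3) by linarith
    moreover have "0 < ?r" using \<alpha> x by simp
    ultimately have r: "0 < ?r" "?r < \<rho>0" by blast+
    have "?e / ?r = 2 * \<alpha> / (1 - \<alpha>)" using x by simp
    also have "\<dots> \<le> 2 * \<alpha> / (1/2)" using \<alpha> by (intro divide_left_mono) auto
    also have "\<dots> \<le> t" using \<alpha> by simp
    finally have "(?e / ?r) powr \<gamma> \<le> t powr \<gamma>" using C \<alpha> x by (intro powr_mono2) auto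
    then have c: "2 * (C * (?e / ?r) powr \<gamma>) \<le> 1"
      using C t by (simp add: field_simps)
    have "2 * emeasure \<mu> (cball x ?r \<inter> nbhd L ?e)
       \<le> 2 * (ennreal (C * (?e / ?r) powr \<gamma>) * emeasure \<mu> (cball x ?r))"
      using dec[OF x(4,1) r, of ?e] \<alpha> x by (intro mult_left_mono) auto
    also have "\<dots> = ennreal (2 * (C * (?e / ?r) powr \<gamma>)) * emeasure \<mu> (cball x ?r)"
      using C by (subst ennreal_mult) (auto simp: mult.assoc)
    also have "\<dots> \<le> 1 * emeasure \<mu> (cball x ?r)"
      using c by (intro mult_right_mono) auto
    finally show "2 * emeasure \<mu> (cball x ?r \<inter> nbhd L ?e) \<le> emeasure \<mu> (cball x ?r)" by simp
  qed (use \<alpha> C in auto)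
qed

section \<open>From positional strategies to the game\<close>

text \<open>Bob's first radius \<open>R\<close> determines all radii, so it suffices to give Alice,
  for each \<open>R\<close>, a rule that sees only the move number and Bob's current centre. The
  bounds with \<open>1 - \<alpha>\<close> and \<open>1 - \<beta>\<close> are \<open>sub_s\<close>
  with the radii substituted.\<close>

lemma positional_strategy_wins:
  fixes K S :: "'a::metric_space set"
  assumes ab: "0 < \<alpha>" "\<alpha> < 1" "0 < \<beta>" "\<beta> < 1"
    and strat: "\<And>R. R > 0 \<Longrightarrow> \<exists>g.
      (\<forall>k. \<forall>x\<in>K. g k x \<in> K \<and> dist x (g k x) \<le> (1 - \<alpha>) * (R * (\<alpha> * \<beta>) ^ k)) \<and>
      (\<forall>c. (\<forall>k. c k \<in> K \<and> dist (g k (c k)) (c (Suc k)) \<le> (1 - \<beta>) * (\<alpha> * (R * (\<alpha> * \<beta>) ^ k))) \<longrightarrow>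
         (\<forall>x\<in>K. (\<forall>k. dist (c k) x \<le> R * (\<alpha> * \<beta>) ^ k) \<longrightarrow> x \<in> S))"
  shows "ab_winning \<alpha> \<beta> K S"
proof -
  define P where "P R g \<longleftrightarrow> (\<forall>k. \<forall>x\<in>K. g k x \<in> K \<and> dist x (g k x) \<le> (1 - \<alpha>) * (R * (\<alpha> * \<beta>) ^ k)) \<and>
      (\<forall>c. (\<forall>k. c k \<in> K \<and> dist (g k (c k)) (c (Suc k)) \<le> (1 - \<beta>) * (\<alpha> * (R * (\<alpha> * \<beta>) ^ k))) \<longrightarrow>
         (\<forall>x\<in>K. (\<forall>k. dist (c k) x \<le> R * (\<alpha> * \<beta>) ^ k) \<longrightarrow> x \<in> S))" for R g
  define g where "g R = (SOME g. P R g)" for R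
  have P: "P R (g R)" if "R > 0" for R
    unfolding g_def by (rule someI_ex[of "P R"], unfold P_def, rule strat[OF that])
  have g: "g R k x \<in> K \<and> dist x (g R k x) \<le> (1 - \<alpha>) * (R * (\<alpha> * \<beta>) ^ k)"
    if "R > 0" "x \<in> K" for R k x
    using P[OF that(1)] that(2) unfolding P_def by blast
  have win: "x \<in> S"
    if "R > 0" "\<forall>k. c k \<in> K \<and> dist (g R k (c k)) (c (Suc k)) \<le> (1 - \<beta>) * (\<alpha> * (R * (\<alpha> * \<beta>) ^ k))"
      "x \<in> K" "\<forall>k. dist (c k) x \<le> R * (\<alpha> * \<beta>) ^ k" for R c x
    using P[OF that(1)] that(2-4) unfolding P_def by blast
  \<comment> \<open>The first entry of the list supplies \<open>R\<close>; after Bob's move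
    \<open>k\<close> the list has length \<open>k + 1\<close>, whence the index
    \<open>length bs - 1\<close>.\<close>
  define F where "F bs = (g (snd (hd bs)) (length bs - 1) (fst (last bs)), \<alpha> * snd (last bs))" for bs
  have F: "alice_move F b k = (g (snd (b 0)) k (fst (b k)), \<alpha> * snd (b k))" for b k
  proof -
    have "hd (map b [0..<Suc k]) = b 0" by (simp add: hd_map del: upt_Suc)
    then show ?thesis by (simp add: alice_move_def F_def)
  qed
  have radius: "snd (b k) = snd (b 0) * (\<alpha> * \<beta>) ^ k" if "bob_legal \<alpha> \<beta> K F b k" for b k
  proof -
    have "j \<le> k \<Longrightarrow> snd (b j) = snd (b 0) * (\<alpha> * \<beta>) ^ j" for j
    proof (induction j)
      case (Suc j)
      have "snd (b (Suc j)) = \<beta> * (\<alpha> * snd (b j))"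
        using that Suc.prems unfolding bob_legal_def by auto
      then show ?case using Suc by simp
    qed simp
    then show ?thesis by blast
  qed
  have centre: "fst (b k) \<in> K" if "bob_legal \<alpha> \<beta> K F b k" for b k
    using that unfolding bob_legal_def by (cases k) blast+
  show ?thesis
    unfolding ab_winning_def
  proof (intro conjI ab exI[of _ F] allI impI)
    fix b k assume legal: "bob_legal \<alpha> \<beta> K F b k"
    have "snd (b 0) > 0" using legal by (simp add: bob_legal_def)
    from g[OF this centre[OF legal], of k] show "alice_legal \<alpha> K (b k) (alice_move F b k)"
      unfolding alice_legal_def sub_s_def F fst_conv snd_conv radius[OF legal]
      by (auto simp: algebra_simps)
  next
    fix b x assume legal: "\<forall>k. bob_legal \<alpha> \<beta> K F b k" and x: "\<forall>k. x \<in> Kball K (b k)"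
    have pos: "snd (b 0) > 0" using legal by (simp add: bob_legal_def)
    have xK: "x \<in> K" using x by (simp add: Kball_def)
    have "x \<in> S"
    proof (rule win[of "snd (b 0)" "\<lambda>k. fst (b k)"])
      show "\<forall>k. fst (b k) \<in> K \<and> dist (g (snd (b 0)) k (fst (b k))) (fst (b (Suc k)))
          \<le> (1 - \<beta>) * (\<alpha> * (snd (b 0) * (\<alpha> * \<beta>) ^ k))"
      proof (intro allI conjI)
        fix k
        show "fst (b k) \<in> K" using centre legal by blast
        have "sub_s (b (Suc k)) (alice_move F b k)"
          using legal[rule_format, of "Suc k"] by (simp add: bob_legal_def)
        then show "dist (g (snd (b 0)) k (fst (b k))) (fst (b (Suc k)))
          \<le> (1 - \<beta>) * (\<alpha> * (snd (b 0) * (\<alpha> * \<beta>) ^ k))"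
          using radius[of b k] radius[of b "Suc k"] legal
          by (auto simp: sub_s_def F algebra_simps)
      qed
      show "\<forall>k. dist (fst (b k)) x \<le> snd (b 0) * (\<alpha> * \<beta>) ^ k"
        using x radius legal by (metis (mono_tags, lifting) Kball_def mem_Collect_eq)
    qed (use pos xK in auto)
    then show "x \<in> S \<inter> K" using xK by blast
  qed
qed

section \<open>Counting in dyadic intervals and repeated halving\<close>

lemma card_dyadic_windows:
  fixes Y :: "'a::real_normed_vector set"
  assumes D: "\<And>N. N > 0 \<Longrightarrow> finite {y\<in>Y. N \<le> norm y \<and> norm y < 2 * N} \<and>
      card {y\<in>Y. N \<le> norm y \<and> norm y < 2 * N} \<le> D"
    and N: "N > 0"
  shows "finite {y\<in>Y. N \<le> norm y \<and> norm y < 2 ^ i * N} \<and>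
      card {y\<in>Y. N \<le> norm y \<and> norm y < 2 ^ i * N} \<le> i * D"
proof (induction i)
  case 0
  have "{y\<in>Y. N \<le> norm y \<and> norm y < 2 ^ 0 * N} = {}" by auto
  then show ?case by (metis card.empty finite.emptyI le0)
next
  case (Suc i)
  let ?A = "{y\<in>Y. N \<le> norm y \<and> norm y < 2 ^ i * N}"
  let ?B = "{y\<in>Y. 2 ^ i * N \<le> norm y \<and> norm y < 2 * (2 ^ i * N)}"
  let ?C = "{y\<in>Y. N \<le> norm y \<and> norm y < 2 ^ Suc i * N}"
  have sub: "?C \<subseteq> ?A \<union> ?B" by auto
  have fB: "finite ?B" "card ?B \<le> D" using D[of "2 ^ i * N"] N by auto
  then have fin: "finite (?A \<union> ?B)" using Suc by auto
  have "card ?C \<le> card (?A \<union> ?B)" using fin sub by (rule card_mono)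
  also have "\<dots> \<le> card ?A + card ?B" by (rule card_Un_le)
  finally show ?case using finite_subset[OF sub fin] fB Suc by auto
qed

lemma halving_reaches_zero:
  fixes f :: "nat \<Rightarrow> nat"
  assumes "\<And>i. i < r \<Longrightarrow> 2 * f (Suc i) \<le> f i" "f 0 < 2 ^ r"
  shows "f r = 0"
proof -
  have "i \<le> r \<Longrightarrow> 2 ^ i * f i \<le> f 0" for i
  proof (induction i)
    case (Suc i)
    have "2 ^ Suc i * f (Suc i) = 2 ^ i * (2 * f (Suc i))" by simp
    also have "\<dots> \<le> 2 ^ i * f i" using Suc.prems assms(1)[of i] by (intro mult_left_mono) auto
    also have "\<dots> \<le> f 0" using Suc by simp
    finally show ?case .
  qed simp
  from this[of r] assms(2) show ?thesis by (cases "f r") auto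
qed

text \<open>Supplies the length \<open>r\<close> of a block of moves: \<open>r\<close> halvings
  dispose of fewer than \<open>2 ^ r\<close> vectors, whereas the number to be treated is bounded by
  a constant or linearly in \<open>r\<close>.\<close>

lemma exists_power2_gt_linear:
  fixes a b :: nat
  obtains r :: nat where "r \<ge> 1" "a < 2 ^ r" "b * r < 2 ^ r"
proof -
  define s where "s = a + b + 2"
  have s: "s < 2 ^ s" by (rule less_exp)
  have "b * (2 * s) < s * (2 * s)" by (intro mult_strict_right_mono) (auto simp: s_def)
  also have "\<dots> \<le> 2 ^ (2 * s)"
  proof -
    have "s * s * 2 \<le> 2 ^ (2 * s)"
    proof -
      have "2 * s \<le> 2 ^ s" using less_exp[of "s - 1"] by (cases s) (auto simp: s_def)
      then have "(2 * s) * s \<le> 2 ^ s * 2 ^ s" using s by (intro mult_mono) auto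
      then show ?thesis unfolding mult_2 power_add by (simp add: algebra_simps)
    qed
    then show ?thesis by (simp add: algebra_simps)
  qed
  finally have "b * (2 * s) < 2 ^ (2 * s)" .
  moreover have "a < 2 ^ (2 * s)" using less_exp[of "2 * s"] by (auto simp: s_def)
  moreover have "2 * s \<ge> 1" by (simp add: s_def)
  ultimately show ?thesis using that by blast
qed

section \<open>Winning against a sparse family of vectors\<close>

definition inhomogeneous_bad :: "'a::euclidean_space set \<Rightarrow> 'a set" where
  "inhomogeneous_bad Y = {x. \<exists>\<delta>>0. \<forall>y\<in>Y. \<forall>p\<in>\<int>. \<delta> \<le> \<bar>y \<bullet> x - p\<bar>}"

text \<open>Block \<open>w\<close> of \<open>r\<close> moves treats the vectors in the window
  \<open>W w\<close>, whose norms are comparable to the inverse radius. There are fewer than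
  \<open>2 ^ r\<close> of them and each move halves the number still bad, so none survives the
  block. The bound \<open>D\<close> affects \<open>r\<close> and \<delta>, but \<alpha> is given by
  \<open>half\<close>.\<close>

lemma inhomogeneous_bad_ab_winning:
  fixes \<mu> :: "'a::euclidean_space measure"
  assumes lf: "locally_finite_borel \<mu>"
    and ab: "0 < \<alpha>" "\<alpha> < 1" "0 < \<beta>" "\<beta> < 1" and \<rho>0: "0 < \<rho>0"
    and half: "\<And>x \<rho> L. \<lbrakk>x \<in> measure_support \<mu>; 0 < \<rho>; \<rho> < \<rho>0; affine_hyperplane L\<rbrakk> \<Longrightarrow>
      2 * emeasure \<mu> (cball x ((1 - \<alpha>) * \<rho>) \<inter> nbhd L (2 * \<alpha> * \<rho>)) \<le> emeasure \<mu> (cball x ((1 - \<alpha>) * \<rho>))"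
    and Y1: "\<And>y. y \<in> Y \<Longrightarrow> 1 \<le> norm y"
    and D: "\<And>N. N > 0 \<Longrightarrow> finite {y\<in>Y. N \<le> norm y \<and> norm y < 2 * N} \<and>
      card {y\<in>Y. N \<le> norm y \<and> norm y < 2 * N} \<le> D"
  shows "ab_winning \<alpha> \<beta> (measure_support \<mu>) (inhomogeneous_bad Y)"
proof (rule positional_strategy_wins[OF ab])
  fix R :: real assume R: "R > 0"
  define \<theta> where "\<theta> = \<alpha> * \<beta>"
  have \<theta>: "0 < \<theta>" "\<theta> < 1"
    using ab mult_strict_mono[of \<alpha> 1 \<beta> 1] by (auto simp: \<theta>_def)
  define \<rho> where "\<rho> k = R * \<theta> ^ k" for k
  have \<rho>_pos: "\<rho> k > 0" for k using R \<theta> by (simp add: \<rho>_def)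
  have \<rho>_add: "\<rho> (i + j) = \<rho> i * \<theta> ^ j" for i j by (simp add: \<rho>_def power_add)
  have \<rho>_anti: "\<rho> j \<le> \<rho> i" if "i \<le> j" for i j
    using that R \<theta> by (auto simp: \<rho>_def intro!: power_decreasing)
  have \<rho>_Suc: "\<rho> (Suc k) = \<beta> * (\<alpha> * \<rho> k)" for k by (simp add: \<rho>_def \<theta>_def)
  have \<rho>_small: "\<exists>k. \<rho> k < e" if "e > 0" for e
    using real_arch_pow_inv[of "e / R" \<theta>] that R \<theta> by (auto simp: \<rho>_def field_simps)
  \<comment> \<open>The first \<open>k0\<close> moves only shrink the ball until \<open>half\<close>
    becomes available.\<close>
  obtain k0 where k0: "\<rho> k0 < \<rho>0" using \<rho>_small[OF \<rho>0] by blast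
  \<comment> \<open>Over one block \<open>hi\<close> grows by the factor
    \<open>(1 / \<theta>) ^ r\<close>, so a later window is covered by \<open>l * r\<close> dyadic
    intervals; window 0 is covered by \<open>i0\<close> of them.\<close>
  obtain l where l: "1 / \<theta> < 2 ^ l" using real_arch_pow[of 2 "1 / \<theta>"] by auto
  obtain i0 where i0: "1 / (4 * \<rho> k0) < 2 ^ i0" using real_arch_pow[of 2 "1 / (4 * \<rho> k0)"] by auto
  obtain r where r: "r \<ge> 1" "i0 * D < 2 ^ r" "l * D * r < 2 ^ r"
    using exists_power2_gt_linear .
  define s where "s w = k0 + w * r" for w
  \<comment> \<open>Norms below \<open>hi w\<close> give \<open>norm y * \<rho> k < 1 / 4\<close>
    throughout the block; together with \<open>\<delta> < 1 / 4\<close> this leaves one hyperplane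
    per vector. The windows adjoin, starting at 1 by \<open>Y1\<close>.\<close>
  define hi where "hi w = 1 / (4 * \<rho> (s w))" for w
  define lo where "lo w = (if w = 0 then 1 else hi (w - 1))" for w
  define W where "W w = {y\<in>Y. lo w \<le> norm y \<and> norm y < hi w}" for w
  have s_Suc: "s (Suc w) = s w + r" for w by (simp add: s_def)
  have hi_pos: "hi w > 0" for w using \<rho>_pos by (simp add: hi_def)
  have W: "finite (W w) \<and> card (W w) < 2 ^ r" for w
  proof (cases w)
    case 0
    let ?A = "{y\<in>Y. 1 \<le> norm y \<and> norm y < 2 ^ i0 * 1}"
    have sub: "W w \<subseteq> ?A" using 0 i0 by (auto simp: W_def lo_def hi_def s_def)
    have A: "finite ?A \<and> card ?A \<le> i0 * D" by (rule card_dyadic_windows[OF D]) auto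
    then show ?thesis using card_mono[OF _ sub] finite_subset[OF sub] r by linarith
  next
    case (Suc v)
    let ?A = "{y\<in>Y. hi v \<le> norm y \<and> norm y < 2 ^ (l * r) * hi v}"
    have "hi w = (1 / \<theta>) ^ r * hi v"
      using Suc \<theta> by (simp add: hi_def s_Suc \<rho>_add power_one_over)
    also have "\<dots> \<le> (2 ^ l) ^ r * hi v"
      using l \<theta> hi_pos[of v] by (intro mult_right_mono power_mono) auto
    finally have "hi w \<le> 2 ^ (l * r) * hi v" by (simp add: power_mult)
    then have sub: "W w \<subseteq> ?A" using Suc by (auto simp: W_def lo_def)
    have A: "finite ?A \<and> card ?A \<le> (l * r) * D" by (rule card_dyadic_windows[OF D hi_pos]) auto
    then have "card (W w) \<le> l * r * D" using card_mono[OF _ sub] by linarith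
    also have "\<dots> = l * D * r" by simp
    finally show ?thesis using finite_subset[OF sub] A r by linarith
  qed
  \<comment> \<open>The second term serves window 0 only, which contains all short vectors and depends on Bob's
    first radius.\<close>
  define \<delta> where "\<delta> = min (\<alpha> * \<theta> ^ (2 * r) / 4) (\<alpha> * \<rho> k0 * \<theta> ^ r)"
  have \<delta>_pos: "\<delta> > 0" using ab \<theta> \<rho>_pos by (simp add: \<delta>_def)
  have \<delta>_less: "\<delta> < 1 / 4"
  proof -
    have "\<alpha> * \<theta> ^ (2 * r) \<le> \<alpha> * 1" using ab \<theta> by (intro mult_left_mono power_le_one) auto
    then have "\<alpha> * \<theta> ^ (2 * r) / 4 < 1 / 4" using ab by linarith
    then show ?thesis by (simp add: \<delta>_def min_less_iff_disj)
  qed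
  have W_bounds: "y \<noteq> 0 \<and> \<delta> \<le> norm y * (\<alpha> * \<rho> k) \<and> 2 * \<delta> + 2 * (norm y * \<rho> k) < 1"
    if y: "y \<in> W w" and k: "s w \<le> k" "k \<le> s (Suc w)" for y w k
  proof (intro conjI)
    have yn: "1 \<le> norm y" "lo w \<le> norm y" "norm y < hi w" using y Y1 by (auto simp: W_def)
    then show "y \<noteq> 0" by auto
    have "norm y * \<rho> k \<le> norm y * \<rho> (s w)" using \<rho>_anti[OF k(1)] by (intro mult_left_mono) auto
    also have "\<dots> < 1 / 4" using yn(3) \<rho>_pos[of "s w"] by (simp add: hi_def field_simps)
    finally show "2 * \<delta> + 2 * (norm y * \<rho> k) < 1" using \<delta>_less by linarith
    have "\<delta> \<le> \<alpha> * (lo w * \<rho> (s (Suc w)))"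
    proof (cases w)
      case 0
      then show ?thesis by (simp add: \<delta>_def lo_def s_def \<rho>_add mult.assoc)
    next
      case (Suc v)
      \<comment> \<open>\<open>lo w\<close> is set by the radius at the start of the preceding
        block, and block \<open>w\<close> ends two blocks after that, whence the exponent
        \<open>2 * r\<close>.\<close>
      have "lo w * \<rho> (s (Suc w)) = \<theta> ^ (2 * r) / 4"
        using Suc \<rho>_pos[of "s v"] by (simp add: lo_def hi_def s_Suc \<rho>_add mult_2 power_add)
      then have "\<alpha> * (lo w * \<rho> (s (Suc w))) = \<alpha> * \<theta> ^ (2 * r) / 4" by (simp only: times_divide_eq_right)
      then show ?thesis by (simp only: \<delta>_def min.cobounded1)
    qed
    also have "\<dots> \<le> \<alpha> * (norm y * \<rho> k)"
      using yn \<rho>_anti[OF k(2)] ab \<rho>_pos[of "s (Suc w)"]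
      by (intro mult_left_mono mult_mono) auto
    finally show "\<delta> \<le> norm y * (\<alpha> * \<rho> k)" by (simp add: mult_ac)
  qed
  define blk where "blk k = (k - k0) div r" for k
  have blk: "s (blk k) \<le> k" "k \<le> s (Suc (blk k))" if "k0 \<le> k" for k
  proof -
    have "(k - k0) div r * r + (k - k0) mod r = k - k0" by simp
    moreover have "(k - k0) mod r < r" using r by simp
    ultimately show "s (blk k) \<le> k" "k \<le> s (Suc (blk k))"
      using that unfolding s_def blk_def mult_Suc by linarith+
  qed
  have blk_eq: "blk (s w + i) = w" if "i < r" for w i
    using that r by (simp add: blk_def s_def)
  \<comment> \<open>Before move \<open>k0\<close> no halving is demanded, and keeping the centre is
    a valid choice.\<close>
  define good where "good k x x' \<longleftrightarrow> x' \<in> measure_support \<mu> \<and> dist x x' \<le> (1 - \<alpha>) * \<rho> k \<and>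
      (k0 \<le> k \<longrightarrow> 2 * card (bad_vectors \<delta> (W (blk k)) x' (\<alpha> * \<rho> k)) \<le> card (bad_vectors \<delta> (W (blk k)) x (\<rho> k)))"
    for k x x'
  have good_ex: "\<exists>x'. good k x x'"
    if x: "x \<in> measure_support \<mu>" for k x
  proof (cases "k0 \<le> k")
    case True
    have k: "\<rho> k < \<rho>0" using \<rho>_anti[OF True] k0 by simp
    show ?thesis
      unfolding good_def using halve_bad_vectors[OF lf x ab(1,2) \<rho>_pos[of k], of "W (blk k)" \<delta>]
        half[OF x \<rho>_pos k] W[of "blk k"] W_bounds[OF _ blk[OF True]] by blast
  next
    case False
    then show ?thesis unfolding good_def using x ab \<rho>_pos[of k] by (intro exI[of _ x]) auto
  qed
  define g where "g k x = (SOME x'. good k x x')" for k x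
  have "good k x (g k x)" if "x \<in> measure_support \<mu>" for k x
    unfolding g_def by (rule someI_ex[OF good_ex[OF that]])
  note g = this[unfolded good_def]
  have win: "x \<in> inhomogeneous_bad Y"
    if c: "\<And>k. c k \<in> measure_support \<mu>" "\<And>k. dist (g k (c k)) (c (Suc k)) \<le> (1 - \<beta>) * (\<alpha> * \<rho> k)"
      and x: "\<And>k. dist (c k) x \<le> \<rho> k" for c x
  proof -
    have empty: "bad_vectors \<delta> (W w) (c (s (Suc w))) (\<rho> (s (Suc w))) = {}" for w
    proof -
      \<comment> \<open>Counts the vectors still bad after \<open>i\<close> moves of block
        \<open>w\<close>. Bob's reply cannot increase it, as his ball lies inside Alice's.\<close>
      define f where "f i = card (bad_vectors \<delta> (W w) (c (s w + i)) (\<rho> (s w + i)))" for i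
      have fin: "finite (bad_vectors \<delta> (W w) z e)" for z e
        using W[of w] by (auto simp: bad_vectors_def)
      have "f r = 0"
      proof (rule halving_reaches_zero[of r f])
        have "f 0 \<le> card (W w)"
          unfolding f_def using W[of w] by (intro card_mono) (auto simp: bad_vectors_def)
        then show "f 0 < 2 ^ r" using W[of w] by linarith
        fix i assume i: "i < r"
        let ?k = "s w + i"
        have "bad_vectors \<delta> (W w) (c (Suc ?k)) (\<rho> (Suc ?k)) \<subseteq> bad_vectors \<delta> (W w) (g ?k (c ?k)) (\<alpha> * \<rho> ?k)"
          using c(2)[of ?k] \<rho>_Suc[of ?k] by (intro bad_vectors_mono) (auto simp: algebra_simps)
        then have "f (Suc i) \<le> card (bad_vectors \<delta> (W w) (g ?k (c ?k)) (\<alpha> * \<rho> ?k))"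
          unfolding f_def using fin by (simp add: card_mono)
        also have "2 * \<dots> \<le> f i"
          using g[OF c(1)[of ?k], of ?k] blk_eq[OF i, of w] by (simp add: f_def s_def)
        finally show "2 * f (Suc i) \<le> f i" by simp
      qed
      then show ?thesis using fin by (simp add: f_def s_Suc)
    qed
    have "\<delta> \<le> \<bar>y \<bullet> x - p\<bar>" if y: "y \<in> Y" and p: "p \<in> \<int>" for y p
    proof -
      have ex: "\<exists>w. norm y < hi w"
      proof -
        have ny: "norm y > 0" using Y1[OF y] by linarith
        then obtain k where k: "\<rho> k < 1 / (4 * norm y)" using \<rho>_small[of "1 / (4 * norm y)"] by auto
        have "k \<le> s k" using r by (simp add: s_def trans_le_add2)
        then have "\<rho> (s k) < 1 / (4 * norm y)" using k \<rho>_anti[of k "s k"] by linarith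
        then have "norm y < hi k" using \<rho>_pos[of "s k"] ny by (simp add: hi_def field_simps)
        then show ?thesis ..
      qed
      define w where "w = (LEAST w. norm y < hi w)"
      have w: "norm y < hi w" unfolding w_def by (rule LeastI_ex[OF ex])
      have "lo w \<le> norm y"
      proof (cases w)
        case 0
        then show ?thesis using Y1[OF y] by (simp add: lo_def)
      next
        case (Suc v)
        then have "\<not> norm y < hi v" unfolding w_def by (metis lessI not_less_Least)
        then show ?thesis using Suc by (simp add: lo_def)
      qed
      then have "y \<in> W w" using w y by (simp add: W_def)
      \<comment> \<open>The outcome \<open>x\<close> lies in the ball at the end of the block, so it
        would itself witness that \<open>y\<close> is bad there.\<close>
      then show ?thesis using empty[of w] x[of "s (Suc w)"] p
        unfolding bad_vectors_def by (smt (verit) empty_iff mem_Collect_eq)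
    qed
    then show ?thesis using \<delta>_pos by (auto simp: inhomogeneous_bad_def)
  qed
  show "\<exists>g. (\<forall>k. \<forall>x\<in>measure_support \<mu>. g k x \<in> measure_support \<mu> \<and>
        dist x (g k x) \<le> (1 - \<alpha>) * (R * (\<alpha> * \<beta>) ^ k)) \<and>
      (\<forall>c. (\<forall>k. c k \<in> measure_support \<mu> \<and>
          dist (g k (c k)) (c (Suc k)) \<le> (1 - \<beta>) * (\<alpha> * (R * (\<alpha> * \<beta>) ^ k))) \<longrightarrow>
         (\<forall>x\<in>measure_support \<mu>. (\<forall>k. dist (c k) x \<le> R * (\<alpha> * \<beta>) ^ k) \<longrightarrow> x \<in> inhomogeneous_bad Y))"
    unfolding \<theta>_def[symmetric] \<rho>_def[symmetric]
  proof (intro exI[of _ g] conjI allI ballI impI)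
    show "g k x \<in> measure_support \<mu>" "dist x (g k x) \<le> (1 - \<alpha>) * \<rho> k"
      if "x \<in> measure_support \<mu>" for k x using g[OF that] by blast+
    show "x \<in> inhomogeneous_bad Y"
      if "\<forall>k. c k \<in> measure_support \<mu> \<and> dist (g k (c k)) (c (Suc k)) \<le> (1 - \<beta>) * (\<alpha> * \<rho> k)"
        "\<forall>k. dist (c k) x \<le> \<rho> k" for c x
      by (rule win[of c]) (use that in auto)
  qed
qed

section \<open>Integer points and their norms\<close>

lemma int_points_diff: "x \<in> int_points \<Longrightarrow> y \<in> int_points \<Longrightarrow> x - y \<in> int_points"
  by (simp add: int_points_def)

lemma inner_int_points: "x \<in> int_points \<Longrightarrow> y \<in> int_points \<Longrightarrow> x \<bullet> y \<in> \<int>"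
  by (auto simp: int_points_def inner_vec_def intro!: Ints_sum)

lemma norm_int_points_ge_1:
  fixes y :: "real ^ 'n"
  assumes "y \<in> int_points" "y \<noteq> 0"
  shows "1 \<le> norm y"
proof -
  have "y \<bullet> y \<in> \<int>" "y \<bullet> y > 0" using assms inner_int_points by auto
  then have "1 \<le> y \<bullet> y" by (metis Ints_cases of_int_0_less_iff of_int_1_le_iff int_one_le_iff_zero_less)
  then show ?thesis by (simp add: norm_eq_sqrt_inner)
qed

text \<open>Squared norms of integer points are nonnegative integers, so the well-ordering of
  \<open>nat\<close> applies; the floor only converts the type.\<close>

lemma exists_minimal_norm_int_point:
  fixes P :: "real ^ 'n \<Rightarrow> bool"
  assumes "P y0" and int: "\<And>y. P y \<Longrightarrow> y \<in> int_points"
  shows "\<exists>y. P y \<and> (\<forall>z. P z \<longrightarrow> norm y \<le> norm z)"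
proof -
  obtain y where y: "P y" "\<And>z. P z \<Longrightarrow> nat \<lfloor>y \<bullet> y\<rfloor> \<le> nat \<lfloor>z \<bullet> z\<rfloor>"
    using ex_has_least_nat[of P y0 "\<lambda>y. nat \<lfloor>y \<bullet> y\<rfloor>"] assms(1) by blast
  have "norm y \<le> norm z" if z: "P z" for z
  proof -
    have "y \<bullet> y \<in> \<int>" "z \<bullet> z \<in> \<int>" using int inner_int_points y(1) z by blast+
    then obtain a b where ab: "y \<bullet> y = of_int a" "z \<bullet> z = of_int b" by (auto elim!: Ints_cases)
    moreover have "0 \<le> a" "0 \<le> b" using ab inner_ge_zero[of y] inner_ge_zero[of z] by auto
    ultimately have "y \<bullet> y \<le> z \<bullet> z" using y(2)[OF z] by simp
    then show ?thesis by (simp add: norm_eq_sqrt_inner)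
  qed
  then show ?thesis using y(1) by blast
qed

section \<open>Simultaneous approximation for the transposed matrix\<close>

text \<open>As \<open>A j\<close> is a column of A, \<open>A j \<bullet> y\<close> is entry
  \<open>j\<close> of the transpose of A applied to \<open>y\<close>.\<close>

definition dual_approx :: "nat \<Rightarrow> (nat \<Rightarrow> 'a::real_inner) \<Rightarrow> real \<Rightarrow> 'a \<Rightarrow> bool" where
  "dual_approx m A \<epsilon> y \<longleftrightarrow> (\<forall>j<m. \<bar>A j \<bullet> y - of_int (round (A j \<bullet> y))\<bar> \<le> \<epsilon>)"

lemma dual_approxI:
  assumes "\<And>j. j < m \<Longrightarrow> \<exists>p::int. \<bar>A j \<bullet> y - of_int p\<bar> \<le> \<epsilon>"
  shows "dual_approx m A \<epsilon> y"
  unfolding dual_approx_def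
proof (intro allI impI)
  fix j assume "j < m"
  then obtain p :: int where "\<bar>A j \<bullet> y - of_int p\<bar> \<le> \<epsilon>" using assms by blast
  then show "\<bar>A j \<bullet> y - of_int (round (A j \<bullet> y))\<bar> \<le> \<epsilon>"
    using round_diff_minimal[of "A j \<bullet> y" p] by linarith
qed

text \<open>Pigeonhole: there are \<open>(X + 1) ^ CARD('n)\<close> vectors with entries in
  \<open>{..X}\<close>, more than the \<open>2 ^ (J * m)\<close> cells of side
  \<open>1 / 2 ^ J\<close> in the unit cube. The difference of two vectors sharing a cell is the
  required \<open>y\<close>; its entries are at most \<open>X\<close>, and the l1 norm costs the
  factor \<open>CARD('n)\<close>.\<close>

lemma Dirichlet_dual_approximation:
  fixes A :: "nat \<Rightarrow> real ^ 'n"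
  shows "\<exists>y\<in>int_points. y \<noteq> 0 \<and> dual_approx m A (1 / 2 ^ J) y \<and>
    norm y \<le> real CARD('n) * 2 powr (real J * real m / real CARD('n))"
proof -
  let ?n = "CARD('n)"
  define X where "X = nat \<lfloor>2 powr (real J * real m / real ?n)\<rfloor>"
  define vec where "vec f = (\<chi> i. real (f i))" for f :: "'n \<Rightarrow> nat"
  define cell where "cell f = (\<lambda>j\<in>{..<m}. \<lfloor>frac (A j \<bullet> vec f) * 2 ^ J\<rfloor>)" for f
  let ?D = "PiE (UNIV :: 'n set) (\<lambda>_. {..X})" and ?T = "PiE {..<m} (\<lambda>_. {0..<2 ^ J :: int})"
  have X: "2 powr (real J * real m / real ?n) < real X + 1" "real X \<le> 2 powr (real J * real m / real ?n)"
    unfolding X_def by (linarith, simp)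
  have img: "cell ` ?D \<subseteq> ?T"
  proof (intro image_subsetI PiE_I)
    fix f j assume "j \<in> {..<m}"
    then show "cell f j \<in> {0..<2 ^ J}"
      using frac_lt_1[of "A j \<bullet> vec f"] frac_ge_0[of "A j \<bullet> vec f"]
      by (auto simp: cell_def floor_less_iff)
  qed (simp add: cell_def)
  have "real (card ?T) = 2 ^ (J * m)" by (simp add: card_PiE power_mult)
  also have "\<dots> = (2 powr (real J * real m / real ?n)) ^ ?n"
    by (simp add: powr_realpow[symmetric] powr_powr)
  also have "\<dots> < (real X + 1) ^ ?n" using X(1) by (intro power_strict_mono) auto
  also have "\<dots> = real (card ?D)" by (simp add: card_PiE add.commute)
  finally have "card ?T < card ?D" by simp
  moreover have "card (cell ` ?D) \<le> card ?T" using img by (intro card_mono finite_PiE) auto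
  ultimately have "\<not> inj_on cell ?D" by (intro pigeonhole) simp
  then obtain f f' where f: "f \<in> ?D" "f' \<in> ?D" "f \<noteq> f'" "cell f = cell f'"
    by (auto simp: inj_on_def)
  define y where "y = vec f - vec f'"
  have "y \<in> int_points" by (simp add: y_def vec_def int_points_def)
  moreover have "y \<noteq> 0" using f(3) by (auto simp: y_def vec_def vec_eq_iff)
  moreover have "dual_approx m A (1 / 2 ^ J) y"
  proof (rule dual_approxI)
    fix j assume j: "j < m"
    let ?t = "A j \<bullet> vec f" and ?t' = "A j \<bullet> vec f'"
    have "\<lfloor>frac ?t * 2 ^ J\<rfloor> = \<lfloor>frac ?t' * 2 ^ J\<rfloor>"
      using fun_cong[OF f(4), of j] j by (simp add: cell_def)
    then have "\<bar>frac ?t * 2 ^ J - frac ?t' * 2 ^ J\<bar> \<le> 1" by linarith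
    then have "\<bar>frac ?t - frac ?t'\<bar> * 2 ^ J \<le> 1"
      by (simp only: left_diff_distrib[symmetric] abs_mult power_abs abs_numeral)
    then have "\<bar>frac ?t - frac ?t'\<bar> \<le> 1 / 2 ^ J" by (simp only: pos_le_divide_eq zero_less_power zero_less_numeral)
    then have "\<bar>A j \<bullet> y - of_int (\<lfloor>?t\<rfloor> - \<lfloor>?t'\<rfloor>)\<bar> \<le> 1 / 2 ^ J"
      by (simp add: y_def inner_diff_right frac_def algebra_simps)
    then show "\<exists>p::int. \<bar>A j \<bullet> y - of_int p\<bar> \<le> 1 / 2 ^ J" ..
  qed
  moreover have "norm y \<le> real ?n * 2 powr (real J * real m / real ?n)"
  proof -
    have "norm y \<le> (\<Sum>i\<in>UNIV. \<bar>y $ i\<bar>)" by (rule norm_le_l1_cart)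
    also have "\<dots> \<le> (\<Sum>i\<in>(UNIV::'n set). real X)"
    proof (rule sum_mono)
      fix i :: 'n
      have "f i \<le> X" "f' i \<le> X" using f by (auto simp: PiE_iff)
      then show "\<bar>y $ i\<bar> \<le> real X" by (simp add: y_def vec_def)
    qed
    also have "\<dots> \<le> real ?n * 2 powr (real J * real m / real ?n)"
      using X(2) by (simp add: mult_left_mono)
    finally show ?thesis .
  qed
  ultimately show ?thesis by blast
qed

text \<open>\<open>Y\<close> consists of a shortest approximation \<open>v J\<close> for each level
  \<open>J\<close>, which inherits the Dirichlet bound. Sparseness follows by pigeonhole with a
  number of cells independent of \<open>N\<close>.\<close>

lemma exists_sparse_dual_approximations:
  fixes A :: "nat \<Rightarrow> real ^ 'n"
  obtains Y :: "(real ^ 'n) set" and D where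
    "Y \<subseteq> int_points" "0 \<notin> Y"
    "\<And>N. N > 0 \<Longrightarrow> finite {y\<in>Y. N \<le> norm y \<and> norm y < 2 * N} \<and>
      card {y\<in>Y. N \<le> norm y \<and> norm y < 2 * N} \<le> D"
    "\<And>J. \<exists>y\<in>Y. dual_approx m A (1 / 2 ^ J) y \<and>
      norm y \<le> real CARD('n) * 2 powr (real J * real m / real CARD('n))"
proof -
  let ?n = "CARD('n)"
  define P where "P J y \<longleftrightarrow> y \<in> int_points \<and> y \<noteq> 0 \<and> dual_approx m A (1 / 2 ^ J) y"
    for J :: nat and y :: "real ^ 'n"
  have "\<exists>y. P J y \<and> (\<forall>z. P J z \<longrightarrow> norm y \<le> norm z)" for J
  proof -
    obtain y0 where "P J y0" using Dirichlet_dual_approximation[of m A J] unfolding P_def by blast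
    then show ?thesis by (rule exists_minimal_norm_int_point) (simp add: P_def)
  qed
  then obtain v where v: "\<And>J. P J (v J)" "\<And>J z. P J z \<Longrightarrow> norm (v J) \<le> norm z" by metis
  have P_mono: "P I y" if "P J y" "I \<le> J" for I J y
  proof -
    have "(1::real) / 2 ^ J \<le> 1 / 2 ^ I" using that(2) by (simp add: frac_le power_increasing)
    then show ?thesis using that(1) unfolding P_def dual_approx_def by (meson order_trans)
  qed
  \<comment> \<open>Room for the cells: norms below \<open>2 * N\<close> keep the scaled entries
    within \<open>2 * CARD('n)\<close>, and the second component holds the columns with nonnegative
    error.\<close>
  define T where "T = PiE (UNIV::'n set) (\<lambda>_. {- 2 * int ?n..2 * int ?n}) \<times> Pow {..<m}"
  have T: "finite T" unfolding T_def by (intro finite_cartesian_product finite_PiE) auto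
  show ?thesis
  proof (rule that[of "range v" "card T"])
    show "range v \<subseteq> int_points" "0 \<notin> range v" using v(1) by (auto simp: P_def)
    fix J
    obtain y where y: "P J y" "norm y \<le> real ?n * 2 powr (real J * real m / real ?n)"
      using Dirichlet_dual_approximation[of m A J] unfolding P_def by blast
    show "\<exists>y\<in>range v. dual_approx m A (1 / 2 ^ J) y \<and> norm y \<le> real ?n * 2 powr (real J * real m / real ?n)"
      using v(1)[of J] v(2)[OF y(1)] y(2) by (intro bexI[of _ "v J"]) (auto simp: P_def)
  next
    fix N :: real assume N: "N > 0"
    let ?S = "{y\<in>range v. N \<le> norm y \<and> norm y < 2 * N}"
    define err where "err y j = A j \<bullet> y - of_int (round (A j \<bullet> y))" for y j
    \<comment> \<open>Two vectors in a common cell have a difference shorter than \<open>N\<close> that approximates as well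
      as the worse of the two, against minimality.\<close>
    define cell where "cell y = (\<lambda>i. \<lfloor>real ?n * (y $ i) / N\<rfloor>, {j\<in>{..<m}. err y j \<ge> 0})" for y :: "real ^ 'n"
    have sub: "cell ` ?S \<subseteq> T"
    proof
      fix t assume "t \<in> cell ` ?S"
      then obtain y where y: "t = cell y" "norm y < 2 * N" by auto
      have "\<lfloor>real ?n * (y $ i) / N\<rfloor> \<in> {- 2 * int ?n..2 * int ?n}" for i
      proof -
        have "\<bar>y $ i\<bar> \<le> 2 * N" using component_le_norm_cart[of y i] y by linarith
        then have b: "-2 \<le> y $ i / N" "y $ i / N \<le> 2" using N by (auto simp: field_simps)
        have "real ?n * -2 \<le> real ?n * (y $ i / N)" "real ?n * (y $ i / N) \<le> real ?n * 2"
          by (rule mult_left_mono[OF b(1)], simp, rule mult_left_mono[OF b(2)], simp)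
        then show ?thesis by (auto simp: le_floor_iff floor_le_iff)
      qed
      then show "t \<in> T" using y(1) by (auto simp: T_def cell_def PiE_iff)
    qed
    have close: "v I = v J" if IJ: "I \<le> J" and same: "cell (v I) = cell (v J)" and NI: "N \<le> norm (v I)" for I J
    proof (rule ccontr)
      assume ne: "v I \<noteq> v J"
      let ?z = "v I - v J"
      have PI: "P I (v I)" "P I (v J)" using v(1) P_mono[OF v(1) IJ] by auto
      have "dual_approx m A (1 / 2 ^ I) ?z"
      proof (rule dual_approxI)
        fix j assume j: "j < m"
        have "\<bar>err (v I) j\<bar> \<le> 1 / 2 ^ I" "\<bar>err (v J) j\<bar> \<le> 1 / 2 ^ I"
          using PI j by (auto simp: P_def dual_approx_def err_def)
        \<comment> \<open>Errors of equal sign differ by at most the larger one, so the difference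
          still approximates at level \<open>I\<close>; this is why cells record signs.\<close>
        moreover have "err (v I) j \<ge> 0 \<longleftrightarrow> err (v J) j \<ge> 0"
          using same j by (auto simp: cell_def)
        ultimately have "\<bar>err (v I) j - err (v J) j\<bar> \<le> 1 / 2 ^ I" by linarith
        then have "\<bar>A j \<bullet> ?z - of_int (round (A j \<bullet> v I) - round (A j \<bullet> v J))\<bar> \<le> 1 / 2 ^ I"
          by (simp add: err_def inner_diff_right algebra_simps)
        then show "\<exists>p::int. \<bar>A j \<bullet> ?z - of_int p\<bar> \<le> 1 / 2 ^ I" ..
      qed
      then have "P I ?z" using PI ne int_points_diff by (auto simp: P_def)
      then have "N \<le> norm ?z" using v(2) NI by (meson order_trans)
      moreover have "norm ?z < N"
      proof -
        have "\<bar>?z $ i\<bar> < N / real ?n" for i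
        proof -
          have "\<lfloor>real ?n * (v I $ i) / N\<rfloor> = \<lfloor>real ?n * (v J $ i) / N\<rfloor>"
            using same by (auto simp: cell_def fun_eq_iff)
          then have "\<bar>real ?n * (v I $ i) / N - real ?n * (v J $ i) / N\<bar> < 1" by linarith
          moreover have "real ?n * (v I $ i) / N - real ?n * (v J $ i) / N = ?z $ i / (N / real ?n)"
            using N by (simp add: field_simps)
          ultimately have "\<bar>?z $ i\<bar> / (N / real ?n) < 1" using N by (simp add: abs_divide)
          moreover have "0 < N / real ?n" using N by simp
          ultimately show ?thesis by (simp only: pos_divide_less_eq mult_1)
        qed
        then have "(\<Sum>i\<in>UNIV. \<bar>?z $ i\<bar>) < (\<Sum>i\<in>(UNIV::'n set). N / real ?n)"
          by (intro sum_strict_mono) auto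
        then show ?thesis using norm_le_l1_cart[of ?z] by simp
      qed
      ultimately show False by simp
    qed
    have inj: "inj_on cell ?S"
    proof (rule inj_onI)
      fix y y' assume y: "y \<in> ?S" "y' \<in> ?S" "cell y = cell y'"
      then obtain I J where IJ: "y = v I" "y' = v J" by blast
      show "y = y'"
      proof (cases "I \<le> J")
        case True
        then show ?thesis unfolding IJ by (rule close) (use y IJ in simp_all)
      next
        case False
        then have "J \<le> I" by simp
        then have "v J = v I" by (rule close) (use y IJ in simp_all)
        then show ?thesis unfolding IJ by simp
      qed
    qed
    show "finite ?S \<and> card ?S \<le> card T"
      using inj_on_finite[OF inj sub T] card_inj_on_le[OF inj sub T] by simp
  qed
qed

section \<open>Transference to \<open>Bad\<close>\<close>

text \<open>For given \<open>q\<close>, take the least level \<open>J\<close> at which the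
  approximation errors, weighted by \<open>q\<close>, total at most \<open>\<delta> / 2\<close>.
  Pairing \<open>mat_vec m A q - x - z\<close> with the vector \<open>y\<close> of that level leaves
  an integer minus \<open>y \<bullet> x\<close>, up to this error, hence at least
  \<open>\<delta> / 2\<close> in absolute value. Cauchy-Schwarz turns this into a distance of at
  least \<open>\<delta> / (2 * norm y)\<close>.\<close>

lemma inhomogeneous_bad_subset_Bad:
  fixes A :: "nat \<Rightarrow> real ^ 'n" and Y :: "(real ^ 'n) set"
  assumes m: "m \<ge> 1" and Y: "Y \<subseteq> int_points" "0 \<notin> Y"
    and approx: "\<And>J. \<exists>y\<in>Y. dual_approx m A (1 / 2 ^ J) y \<and>
      norm y \<le> real CARD('n) * 2 powr (real J * real m / real CARD('n))"
  shows "inhomogeneous_bad Y \<subseteq> Bad m A"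
proof
  fix x assume "x \<in> inhomogeneous_bad Y"
  then obtain \<delta> where \<delta>: "\<delta> > 0" "\<And>y p. y \<in> Y \<Longrightarrow> p \<in> \<int> \<Longrightarrow> \<delta> \<le> \<bar>y \<bullet> x - p\<bar>"
    by (auto simp: inhomogeneous_bad_def)
  let ?n = "CARD('n)" and ?e = "real m / real CARD('n)"
  \<comment> \<open>Excludes \<open>J = 0\<close> later, so that minimality of \<open>J\<close> can
    be tested at its predecessor.\<close>
  have \<delta>_le: "\<delta> \<le> 1 / 2"
  proof -
    obtain y where "y \<in> Y" using approx by blast
    then have "\<delta> \<le> \<bar>y \<bullet> x - of_int (round (y \<bullet> x))\<bar>" by (intro \<delta>(2)) auto
    also have "\<dots> \<le> 1 / 2" using of_int_round_abs_le[of "y \<bullet> x"] by (simp add: abs_minus_commute)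
    finally show ?thesis .
  qed
  \<comment> \<open>The result of inserting the bound \<open>ny\<close> for \<open>norm y\<close>
    into \<open>\<delta> / (2 * norm y)\<close>; the power of \<open>int_norm m q\<close>
    cancels.\<close>
  define c where "c = \<delta> / (2 * real ?n * (4 * real m / \<delta>) powr ?e)"
  have c: "c > 0" using \<delta> m by (simp add: c_def)
  have main: "c \<le> int_norm m q powr ?e * infdist (mat_vec m A q - x) int_points"
    if q: "\<exists>j<m. q j \<noteq> 0" for q
  proof -
    let ?Q = "int_norm m q" and ?v = "mat_vec m A q - x"
    have comp: "\<bar>of_int (q j)\<bar> \<le> ?Q" if "j < m" for j
    proof -
      have "(of_int (q j) :: real)\<^sup>2 \<le> (\<Sum>j<m. (of_int (q j))\<^sup>2)"
        using that by (intro member_le_sum) auto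
      then show ?thesis unfolding int_norm_def by (metis real_sqrt_abs real_sqrt_le_iff)
    qed
    obtain j where j: "j < m" "q j \<noteq> 0" using q by blast
    have "(1::real) \<le> \<bar>of_int (q j)\<bar>" using j(2) by linarith
    then have Q1: "1 \<le> ?Q" using comp[OF j(1)] by linarith
    have mQ: "real m * ?Q \<ge> 1" using Q1 m mult_mono[of 1 "real m" 1 ?Q] by simp
    have "\<exists>J. 2 * real m * ?Q / \<delta> < 2 ^ J" by (rule real_arch_pow) simp
    then have ex: "\<exists>J. real m * ?Q / 2 ^ J \<le> \<delta> / 2"
      using \<delta>(1) by (auto simp: field_simps intro: less_imp_le)
    define J where "J = (LEAST J. real m * ?Q / 2 ^ J \<le> \<delta> / 2)"
    have J: "real m * ?Q / 2 ^ J \<le> \<delta> / 2" unfolding J_def by (rule LeastI_ex[OF ex])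
    have "J \<noteq> 0"
    proof
      assume "J = 0"
      then show False using J mQ \<delta>_le by simp
    qed
    then obtain I where I: "J = Suc I" by (cases J) auto
    then have "\<not> real m * ?Q / 2 ^ I \<le> \<delta> / 2" unfolding J_def by (metis lessI not_less_Least)
    \<comment> \<open>Failure at level \<open>I\<close> bounds \<open>2 ^ J\<close> by a multiple of
      the norm of \<open>q\<close>, which makes the Dirichlet bound on \<open>norm y\<close> a
      multiple of that norm to the power \<open>m / n\<close>.\<close>
    then have J2: "2 ^ J \<le> 4 * real m / \<delta> * ?Q" using \<delta>(1) I by (simp add: field_simps)
    obtain y where y: "y \<in> Y" "dual_approx m A (1 / 2 ^ J) y"
      "norm y \<le> real ?n * 2 powr (real J * real m / real ?n)" using approx by blast
    have y_pos: "norm y > 0" using y(1) Y by auto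
    have "2 powr (real J * real m / real ?n) = (2 ^ J) powr ?e"
      by (simp add: powr_realpow[symmetric] powr_powr)
    also have "\<dots> \<le> (4 * real m / \<delta> * ?Q) powr ?e" using J2 by (intro powr_mono2) auto
    also have "\<dots> = (4 * real m / \<delta>) powr ?e * ?Q powr ?e"
      using \<delta>(1) Q1 by (simp only: powr_mult)
    finally have ny: "norm y \<le> real ?n * ((4 * real m / \<delta>) powr ?e * ?Q powr ?e)"
      using y(3) by (smt (verit) mult_left_mono of_nat_0_le_iff)
    have far: "\<delta> / (2 * norm y) \<le> dist ?v z" if z: "z \<in> int_points" for z
    proof -
      let ?r = "\<lambda>j. round (A j \<bullet> y)"
      \<comment> \<open>Gathers all integer contributions to the pairing, including
        \<open>y \<bullet> z\<close>.\<close>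
      define p where "p = (\<Sum>j<m. of_int (q j) * of_int (?r j)) - y \<bullet> z"
      have p: "p \<in> \<int>" unfolding p_def using inner_int_points[of y z] y(1) Y z by (intro Ints_diff Ints_sum) auto
      have eq: "y \<bullet> (?v - z) = (\<Sum>j<m. of_int (q j) * (A j \<bullet> y - of_int (?r j))) - (y \<bullet> x - p)"
        by (simp add: mat_vec_def p_def inner_diff_right inner_sum_right right_diff_distrib
            sum_subtractf inner_commute[of y "A _"])
      have "\<bar>\<Sum>j<m. of_int (q j) * (A j \<bullet> y - of_int (?r j))\<bar> \<le> (\<Sum>j<m. ?Q * (1 / 2 ^ J))"
      proof (rule order_trans[OF sum_abs], rule sum_mono)
        fix j assume "j \<in> {..<m}"
        then show "\<bar>of_int (q j) * (A j \<bullet> y - of_int (?r j))\<bar> \<le> ?Q * (1 / 2 ^ J)"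
          unfolding abs_mult using comp[of j] y(2) Q1
          by (intro mult_mono) (auto simp: dual_approx_def)
      qed
      also have "\<dots> \<le> \<delta> / 2" using J by simp
      finally have "\<delta> / 2 \<le> \<bar>y \<bullet> (?v - z)\<bar>" using \<delta>(2)[OF y(1) p] eq by linarith
      also have "\<dots> \<le> norm y * dist ?v z" unfolding dist_norm by (rule Cauchy_Schwarz_ineq2)
      finally show ?thesis using y_pos by (simp add: field_simps)
    qed
    have "(0 :: real ^ 'n) \<in> int_points" by (simp add: int_points_def)
    then have inf: "\<delta> / (2 * norm y) \<le> infdist ?v int_points"
      using far by (subst infdist_notempty) (auto intro!: cINF_greatest)
    have Qp: "?Q powr ?e > 0" using Q1 by simp
    have "c = ?Q powr ?e * (\<delta> / (2 * (real ?n * ((4 * real m / \<delta>) powr ?e * ?Q powr ?e))))"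
      using Qp by (simp add: c_def)
    also have "\<dots> \<le> ?Q powr ?e * (\<delta> / (2 * norm y))"
      using ny y_pos \<delta>(1) Qp m by (intro mult_left_mono divide_left_mono mult_pos_pos) auto
    also have "\<dots> \<le> ?Q powr ?e * infdist ?v int_points"
      using inf Qp by (intro mult_left_mono) auto
    finally show ?thesis .
  qed
  \<comment> \<open>A unit vector shows that the infimum runs over a nonempty set.\<close>
  have "(\<lambda>j. if j = 0 then 1 else 0) \<in> {q :: nat \<Rightarrow> int. (\<forall>j\<ge>m. q j = 0) \<and> (\<exists>j<m. q j \<noteq> 0)}"
    using m by auto
  then have "c \<le> (INF q \<in> {q. (\<forall>j\<ge>m. q j = 0) \<and> (\<exists>j<m. q j \<noteq> 0)}.
        int_norm m q powr ?e * infdist (mat_vec m A q - x) int_points)"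
    using main by (intro cINF_greatest) auto
  then show "x \<in> Bad m A" using c by (simp add: Bad_def)
qed

section \<open>Larger targets and the uniform choice of \<alpha>\<close>

lemma ab_winning_mono:
  assumes "ab_winning \<alpha> \<beta> K S" "S \<subseteq> S'"
  shows "ab_winning \<alpha> \<beta> K S'"
proof -
  obtain F where "\<forall>b. (\<forall>k. bob_legal \<alpha> \<beta> K F b k \<longrightarrow> alice_legal \<alpha> K (b k) (alice_move F b k)) \<and>
      ((\<forall>k. bob_legal \<alpha> \<beta> K F b k) \<longrightarrow> (\<forall>x. (\<forall>k. x \<in> Kball K (b k)) \<longrightarrow> x \<in> S \<inter> K))"
    using assms(1) unfolding ab_winning_def by blast
  moreover have "S \<inter> K \<subseteq> S' \<inter> K" using assms(2) by blast
  ultimately show ?thesis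
    using assms(1) unfolding ab_winning_def by (intro conjI exI[of _ F]) (simp_all add: subset_iff)
qed

theorem corollary1p4:
  fixes \<mu> :: "(real ^ 'n) measure"
  assumes "abs_decaying \<mu>"
  shows "\<exists>\<alpha>>0. \<forall>m::nat. m \<ge> 1 \<longrightarrow> (\<forall>A :: nat \<Rightarrow> real ^ 'n.
           alpha_winning \<alpha> (measure_support \<mu>) (Bad m A))"
proof -
  have lf: "locally_finite_borel \<mu>"
    using assms by (auto simp: abs_decaying_def abs_decaying_with_def)
  \<comment> \<open>\<alpha> is fixed by the measure alone, before \<open>m\<close>,
    \<open>A\<close> and \<beta> appear.\<close>
  obtain \<alpha> \<rho>0 where \<alpha>: "0 < \<alpha>" "\<alpha> < 1" "0 < \<rho>0" and half:
    "\<And>x \<rho> L. \<lbrakk>x \<in> measure_support \<mu>; 0 < \<rho>; \<rho> < \<rho>0; affine_hyperplane L\<rbrakk> \<Longrightarrow>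
      2 * emeasure \<mu> (cball x ((1 - \<alpha>) * \<rho>) \<inter> nbhd L (2 * \<alpha> * \<rho>)) \<le> emeasure \<mu> (cball x ((1 - \<alpha>) * \<rho>))"
    using exists_halving_constant[OF assms] by blast
  have "ab_winning \<alpha> \<beta> (measure_support \<mu>) (Bad m A)"
    if m: "m \<ge> 1" and \<beta>: "0 < \<beta>" "\<beta> < 1" for m and A :: "nat \<Rightarrow> real ^ 'n" and \<beta>
  proof -
    obtain Y :: "(real ^ 'n) set" and D where Y: "Y \<subseteq> int_points" "0 \<notin> Y"
      and D: "\<And>N. N > 0 \<Longrightarrow> finite {y\<in>Y. N \<le> norm y \<and> norm y < 2 * N} \<and>
        card {y\<in>Y. N \<le> norm y \<and> norm y < 2 * N} \<le> D"
      and approx: "\<And>J. \<exists>y\<in>Y. dual_approx m A (1 / 2 ^ J) y \<and>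
        norm y \<le> real CARD('n) * 2 powr (real J * real m / real CARD('n))"
      using exists_sparse_dual_approximations[of m A] by blast
    have "ab_winning \<alpha> \<beta> (measure_support \<mu>) (inhomogeneous_bad Y)"
    proof (rule inhomogeneous_bad_ab_winning[OF lf \<alpha>(1,2) \<beta> \<alpha>(3) half _ D])
      show "1 \<le> norm y" if "y \<in> Y" for y using that Y by (intro norm_int_points_ge_1) auto
    qed
    then show ?thesis
      using inhomogeneous_bad_subset_Bad[OF m Y approx] by (rule ab_winning_mono)
  qed
  then show ?thesis using \<alpha> by (auto simp: alpha_winning_def)
qed

end
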